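(* Let $(e_i)$ be a semi-normalized Schauder basis for a Banach space $X$. Suppose that there exists $K>0$ such that, for all $\alpha,\beta\in\operatorname{span}((e_i))$, $$\|\alpha\otimes\beta\|\le K\|\alpha\|\,\|\beta\|,$$ and also that $$\limsup_{n\to\infty}\frac1n\,\underset{\pm}{\operatorname{Ave}}\Big\|\sum_{i=1}^n\pm e_i\Big\|>0.$$ Then $(e_i)$ is equivalent to the unit vector basis of $\ell_1$.
   Context: A sequence $(e_i)$ is semi-normalized if $0<\inf_i\|e_i\|\le\sup_i\|e_i\|<\infty$. $\operatorname{span}((e_i))$ denotes the set of finite linear combinations of the $e_i$. $\operatorname{Ave}_\pm$ denotes the average over all $2^n$ choices of signs. The multiplication $\otimes$ on $\operatorname{span}((e_i))$: for $\alpha=\sum_{i=1}^n a_ie_i$ and $\beta=\sum_{j=1}^m b_je_j$ with $b_m\ne0$, $$\alpha\otimes\beta=\sum_{i=1}^n a_i\Big(\sum_{j=1}^m b_j e_{(i-1)m+j}\Big),$$ and $\alpha\otimes 0=0$. Two basic sequences $(x_i)$, $(y_i)$ are equivalent if there is $C>0$ with $\frac1C\|\sum a_ix_i\|\le\|\sum a_iy_i\|\le C\|\sum a_ix_i\|$ for all finitely supported scalar sequences $(a_i)$. *)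

theory Defs
  imports "HOL-Analysis.Analysis"
begin

text \<open>Banach spaces and scalars are real. Sequences are indexed from \<open>0\<close>, so that \<open>e 0\<close> is the
  first basis vector and the index \<open>(i - 1) m + j\<close> of the 1-based convention
  becomes \<open>i * m + j\<close>.\<close>

definition semi_normalized :: "(nat \<Rightarrow> 'a::real_normed_vector) \<Rightarrow> bool" where
  "semi_normalized e \<longleftrightarrow>
     0 < (INF i. norm (e i)) \<and> bdd_above (range (\<lambda>i. norm (e i)))"

definition schauder_basis :: "(nat \<Rightarrow> 'a::real_normed_vector) \<Rightarrow> bool" where
  "schauder_basis e \<longleftrightarrow> (\<forall>x. \<exists>!a :: nat \<Rightarrow> real. (\<lambda>i. a i *\<^sub>R e i) sums x)"


subsection \<open>The multiplication on the span\<close>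

definition coord :: "(nat \<Rightarrow> 'a::real_vector) \<Rightarrow> 'a \<Rightarrow> nat \<Rightarrow> real" where
  "coord e x i = representation (range e) x (e i)"

text \<open>The length of \<open>x = (\<Sum>i<n. a i *\<^sub>R e i)\<close> with \<open>a (n - 1) \<noteq> 0\<close> is \<open>n\<close>;
  the length of \<open>0\<close> is \<open>0\<close>, so the sum defining \<open>otimes e x 0\<close> is empty.\<close>

definition len :: "(nat \<Rightarrow> 'a::real_vector) \<Rightarrow> 'a \<Rightarrow> nat" where
  "len e x = (LEAST n. \<forall>i\<ge>n. coord e x i = 0)"

definition otimes :: "(nat \<Rightarrow> 'a::real_vector) \<Rightarrow> 'a \<Rightarrow> 'a \<Rightarrow> 'a" where
  "otimes e x y =
     (\<Sum>i<len e x. coord e x i *\<^sub>R (\<Sum>j<len e y. coord e y j *\<^sub>R e (i * len e y + j)))"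

lemma schauder_basis_unique:
  assumes "schauder_basis e" and a: "(\<lambda>i. a i *\<^sub>R e i) sums x" and b: "(\<lambda>i. b i *\<^sub>R e i) sums x"
  shows "a = b"
proof -
  have "\<exists>!a. (\<lambda>i. a i *\<^sub>R e i) sums x"
    using assms(1) by (simp only: schauder_basis_def)
  then obtain c where c: "\<forall>y. (\<lambda>i. y i *\<^sub>R e i) sums x \<longrightarrow> y = c"
    by (elim ex1E)
  show ?thesis using spec[OF c, of a] spec[OF c, of b] a b by simp
qed

lemma schauder_basis_inj:
  assumes "schauder_basis e"
  shows "inj e"
proof (rule injI)
  fix i j assume eq: "e i = e j"
  define d where "d l k = (if k = l then 1 else 0 :: real)" for l k :: nat
  have d: "(\<lambda>k. d l k *\<^sub>R e k) sums e l" for l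
  proof -
    have "(\<lambda>k. d l k *\<^sub>R e k) = (\<lambda>k. if k = l then e k else 0)"
      by (auto simp: d_def)
    then show ?thesis using sums_single[of l e] by metis
  qed
  have "d i = d j"
    using assms d[of i] d[of j, folded eq] by (rule schauder_basis_unique)
  then have "d i i = d j i" by simp
  then show "i = j" by (simp add: d_def split: if_splits)
qed

lemma schauder_basis_independent:
  fixes e :: "nat \<Rightarrow> 'a::real_normed_vector"
  assumes "schauder_basis e"
  shows "independent (range e)"
proof
  assume "dependent (range e)"
  then obtain S u where S: "finite S" "S \<subseteq> range e" "(\<Sum>v\<in>S. u v *\<^sub>R v) = 0" "\<exists>v\<in>S. u v \<noteq> 0"
    unfolding dependent_explicit by blast
  have inj: "inj e" using assms by (rule schauder_basis_inj)
  define I where "I = e -` S"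
  have "finite I" unfolding I_def using S(1) inj by (rule finite_vimageI)
  moreover have "S = e ` I" unfolding I_def using S(2) by (simp add: image_vimage_eq Int_absorb2)
  ultimately have I: "finite I" "S = e ` I" by auto
  define a where "a = (\<lambda>i. if i \<in> I then u (e i) else 0)"
  have "(\<lambda>i. a i *\<^sub>R e i) sums (\<Sum>i\<in>I. a i *\<^sub>R e i)"
    by (rule sums_finite[OF I(1)]) (simp add: a_def)
  also have "(\<Sum>i\<in>I. a i *\<^sub>R e i) = 0"
  proof -
    have "(\<Sum>i\<in>I. a i *\<^sub>R e i) = (\<Sum>i\<in>I. u (e i) *\<^sub>R e i)"
      by (simp add: a_def)
    also have "\<dots> = (\<Sum>v\<in>e ` I. u v *\<^sub>R v)"
      using inj_on_subset[OF inj] by (simp add: sum.reindex)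
    finally show ?thesis using S(3) I(2) by simp
  qed
  finally have "(\<lambda>i. a i *\<^sub>R e i) sums 0" .
  then have "a = (\<lambda>_. 0)"
    by (rule schauder_basis_unique[OF assms]) simp
  moreover obtain i where "i \<in> I" "u (e i) \<noteq> 0" using S(4) I(2) by blast
  then have "a i \<noteq> 0" by (simp add: a_def)
  ultimately show False by simp
qed

lemma coord_sum:
  fixes e :: "nat \<Rightarrow> 'a::real_normed_vector"
  assumes "schauder_basis e"
  shows "coord e (\<Sum>i<n. a i *\<^sub>R e i) k = (if k < n then a k else 0)"
proof -
  note ind = schauder_basis_independent[OF assms]
  have inj: "e k = e i \<longleftrightarrow> k = i" for i
    using schauder_basis_inj[OF assms] by (auto simp: inj_def)
  have "coord e (\<Sum>i<n. a i *\<^sub>R e i) k = (\<Sum>i<n. a i * (if k = i then 1 else 0))"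
    unfolding coord_def
    by (simp add: real_vector.representation_sum[OF ind] span_base span_scale inj
        real_vector.representation_scale[OF ind] real_vector.representation_basis[OF ind])
  then show ?thesis by (simp add: if_distrib cong: if_cong)
qed

lemma otimes_sum:
  fixes e :: "nat \<Rightarrow> 'a::real_normed_vector"
  assumes e: "schauder_basis e" and m: "0 < m" "b (m - 1) \<noteq> 0"
  shows "otimes e (\<Sum>i<n. a i *\<^sub>R e i) (\<Sum>j<m. b j *\<^sub>R e j) =
           (\<Sum>i<n. a i *\<^sub>R (\<Sum>j<m. b j *\<^sub>R e (i * m + j)))"
proof -
  let ?x = "\<Sum>i<n. a i *\<^sub>R e i" and ?y = "\<Sum>j<m. b j *\<^sub>R e j"
  have y: "len e ?y = m"
    unfolding len_def
  proof (rule Least_equality)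
    fix k assume "\<forall>i\<ge>k. coord e ?y i = 0"
    moreover have "coord e ?y (m - 1) \<noteq> 0"
      using m coord_sum[OF e, of b m "m - 1"] by simp
    ultimately have "\<not> k \<le> m - 1" by blast
    then show "m \<le> k" by linarith
  qed (simp add: coord_sum[OF e])
  have n: "\<forall>i\<ge>n. coord e ?x i = 0" by (simp add: coord_sum[OF e])
  have x1: "len e ?x \<le> n"
    unfolding len_def using n by (rule Least_le)
  have x2: "\<forall>i\<ge>len e ?x. coord e ?x i = 0"
    unfolding len_def using n by (rule LeastI)
  have "otimes e ?x ?y =
      (\<Sum>i<n. coord e ?x i *\<^sub>R (\<Sum>j<m. coord e ?y j *\<^sub>R e (i * m + j)))"
    unfolding otimes_def y
  proof (rule sum.mono_neutral_left)
    show "\<forall>i\<in>{..<n} - {..<len e ?x}.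
        coord e ?x i *\<^sub>R (\<Sum>j<m. coord e ?y j *\<^sub>R e (i * m + j)) = 0"
    proof
      fix i assume "i \<in> {..<n} - {..<len e ?x}"
      then have "len e ?x \<le> i" by simp
      then have "coord e ?x i = 0" using x2 by blast
      then show "coord e ?x i *\<^sub>R (\<Sum>j<m. coord e ?y j *\<^sub>R e (i * m + j)) = 0"
        by (simp only: scaleR_zero_left)
    qed
  qed (use x1 in auto)
  also have "\<dots> = (\<Sum>i<n. a i *\<^sub>R (\<Sum>j<m. b j *\<^sub>R e (i * m + j)))"
    by (rule sum.cong[OF refl], rule arg_cong2[where f = scaleR])
       (simp_all add: coord_sum[OF e])
  finally show ?thesis .
qed

lemma otimes_zero_right: "otimes e x 0 = 0"
  by (simp add: otimes_def len_def coord_def real_vector.representation_zero)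


subsection \<open>Averages over signs\<close>

definition sign_average :: "(nat \<Rightarrow> 'a::real_normed_vector) \<Rightarrow> nat \<Rightarrow> real" where
  "sign_average e n =
     (\<Sum>\<epsilon>\<in>{..<n} \<rightarrow>\<^sub>E {-1, 1}. norm (\<Sum>i<n. \<epsilon> i *\<^sub>R e i)) / 2 ^ n"


subsection \<open>The Banach space of absolutely summable sequences\<close>

typedef l1 = "{f :: nat \<Rightarrow> real. summable (\<lambda>i. \<bar>f i\<bar>)}"
  morphisms l1_nth Abs_l1
  by (rule exI[of _ "\<lambda>_. 0"]) simp

setup_lifting type_definition_l1

instantiation l1 :: real_vector
begin

lift_definition zero_l1 :: l1 is "\<lambda>_. 0" by simp

lift_definition plus_l1 :: "l1 \<Rightarrow> l1 \<Rightarrow> l1" is "\<lambda>f g i. f i + g i"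
proof -
  fix f g :: "nat \<Rightarrow> real"
  assume "summable (\<lambda>i. \<bar>f i\<bar>)" "summable (\<lambda>i. \<bar>g i\<bar>)"
  from summable_add[OF this] show "summable (\<lambda>i. \<bar>f i + g i\<bar>)"
    by (rule summable_comparison_test') (auto intro: abs_triangle_ineq)
qed

lift_definition uminus_l1 :: "l1 \<Rightarrow> l1" is "\<lambda>f i. - f i" by simp

lift_definition minus_l1 :: "l1 \<Rightarrow> l1 \<Rightarrow> l1" is "\<lambda>f g i. f i - g i"
proof -
  fix f g :: "nat \<Rightarrow> real"
  assume "summable (\<lambda>i. \<bar>f i\<bar>)" "summable (\<lambda>i. \<bar>g i\<bar>)"
  from summable_add[OF this] show "summable (\<lambda>i. \<bar>f i - g i\<bar>)"
    by (rule summable_comparison_test') (auto intro: abs_triangle_ineq4)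
qed

lift_definition scaleR_l1 :: "real \<Rightarrow> l1 \<Rightarrow> l1" is "\<lambda>c f i. c * f i"
  by (simp add: abs_mult summable_mult)

instance
  by standard (transfer; simp add: fun_eq_iff algebra_simps)+

end

instantiation l1 :: real_normed_vector
begin

lift_definition norm_l1 :: "l1 \<Rightarrow> real" is "\<lambda>f. \<Sum>i. \<bar>f i\<bar>" .

definition dist_l1 :: "l1 \<Rightarrow> l1 \<Rightarrow> real" where "dist_l1 x y = norm (x - y)"

definition sgn_l1 :: "l1 \<Rightarrow> l1" where "sgn_l1 x = x /\<^sub>R norm x"

definition uniformity_l1 :: "(l1 \<times> l1) filter" where
  "uniformity_l1 = (INF e\<in>{0<..}. principal {(x, y). dist x y < e})"

definition open_l1 :: "l1 set \<Rightarrow> bool" where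
  "open_l1 S = (\<forall>x\<in>S. \<forall>\<^sub>F (x', y) in uniformity. x' = x \<longrightarrow> y \<in> S)"

instance
proof
  fix x y :: l1 and c :: real
  show "norm x = 0 \<longleftrightarrow> x = 0"
    by transfer (simp add: suminf_eq_zero_iff fun_eq_iff)
  show "norm (x + y) \<le> norm x + norm y"
  proof transfer
    fix f g :: "nat \<Rightarrow> real"
    assume f: "summable (\<lambda>i. \<bar>f i\<bar>)" and g: "summable (\<lambda>i. \<bar>g i\<bar>)"
    have "summable (\<lambda>i. \<bar>f i + g i\<bar>)"
      using summable_add[OF f g]
      by (rule summable_comparison_test') (auto intro: abs_triangle_ineq)
    then have "(\<Sum>i. \<bar>f i + g i\<bar>) \<le> (\<Sum>i. \<bar>f i\<bar> + \<bar>g i\<bar>)"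
      by (intro suminf_le summable_add f g) (rule abs_triangle_ineq)
    then show "(\<Sum>i. \<bar>f i + g i\<bar>) \<le> (\<Sum>i. \<bar>f i\<bar>) + (\<Sum>i. \<bar>g i\<bar>)"
      by (simp add: suminf_add[OF f g])
  qed
  show "norm (c *\<^sub>R x) = \<bar>c\<bar> * norm x"
    by transfer (simp add: abs_mult suminf_mult)
qed (rule dist_l1_def sgn_l1_def uniformity_l1_def open_l1_def)+

end

lemma sum_l1_nth_le_norm: "(\<Sum>i<n. \<bar>l1_nth x i\<bar>) \<le> norm x"
  by transfer (rule sum_le_suminf; simp)

lemma l1_nth_le_norm: "\<bar>l1_nth x i\<bar> \<le> norm x"
proof -
  have "\<bar>l1_nth x i\<bar> \<le> (\<Sum>j<Suc i. \<bar>l1_nth x j\<bar>)"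
    by (rule member_le_sum) auto
  then show ?thesis using sum_l1_nth_le_norm order_trans by blast
qed

lemma norm_l1_le:
  assumes "\<And>n. (\<Sum>i<n. \<bar>l1_nth x i\<bar>) \<le> c"
  shows "norm x \<le> c"
  using assms by transfer (rule suminf_le_const)

instance l1 :: banach
proof
  fix X :: "nat \<Rightarrow> l1" assume X: "Cauchy X"
  have "Cauchy (\<lambda>n. l1_nth (X n) i)" for i
  proof (rule CauchyI)
    fix r :: real assume "0 < r"
    then obtain M where M: "\<And>m n. M \<le> m \<Longrightarrow> M \<le> n \<Longrightarrow> norm (X m - X n) < r"
      using CauchyD[OF X] by blast
    have "norm (l1_nth (X m) i - l1_nth (X n) i) < r" if "M \<le> m" "M \<le> n" for m n
      using l1_nth_le_norm[of "X m - X n" i] M[OF that] by (simp add: minus_l1.rep_eq)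
    then show "\<exists>M. \<forall>m\<ge>M. \<forall>n\<ge>M. norm (l1_nth (X m) i - l1_nth (X n) i) < r" by blast
  qed
  then have "\<exists>l. (\<lambda>n. l1_nth (X n) i) \<longlonglongrightarrow> l" for i
    using Cauchy_convergent_iff convergent_def by blast
  then obtain g where g: "\<And>i. (\<lambda>n. l1_nth (X n) i) \<longlonglongrightarrow> g i" by metis
  have tail: "\<exists>M. \<forall>m\<ge>M. \<forall>N. (\<Sum>i<N. \<bar>l1_nth (X m) i - g i\<bar>) \<le> r" if "0 < r" for r
  proof -
    obtain M where M: "\<And>m n. M \<le> m \<Longrightarrow> M \<le> n \<Longrightarrow> norm (X m - X n) < r"
      using CauchyD[OF X \<open>0 < r\<close>] by blast
    have "(\<Sum>i<N. \<bar>l1_nth (X m) i - g i\<bar>) \<le> r" if "M \<le> m" for m N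
    proof (rule LIMSEQ_le_const2)
      show "(\<lambda>n. \<Sum>i<N. \<bar>l1_nth (X m) i - l1_nth (X n) i\<bar>)
              \<longlonglongrightarrow> (\<Sum>i<N. \<bar>l1_nth (X m) i - g i\<bar>)"
        by (intro tendsto_intros g)
      have "(\<Sum>i<N. \<bar>l1_nth (X m) i - l1_nth (X n) i\<bar>) \<le> r" if "M \<le> n" for n
        using sum_l1_nth_le_norm[of "X m - X n" N] M[OF \<open>M \<le> m\<close> that]
        by (simp add: minus_l1.rep_eq)
      then show "\<exists>M. \<forall>n\<ge>M. (\<Sum>i<N. \<bar>l1_nth (X m) i - l1_nth (X n) i\<bar>) \<le> r" by blast
    qed
    then show ?thesis by blast
  qed
  obtain m where m: "\<And>N. (\<Sum>i<N. \<bar>l1_nth (X m) i - g i\<bar>) \<le> 1"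
    using tail[of 1] by auto
  have "summable (\<lambda>i. \<bar>g i\<bar>)"
  proof (rule summableI_nonneg_bounded)
    fix N
    have "(\<Sum>i<N. \<bar>g i\<bar>) \<le> (\<Sum>i<N. \<bar>l1_nth (X m) i - g i\<bar> + \<bar>l1_nth (X m) i\<bar>)"
      by (rule sum_mono) auto
    also have "\<dots> \<le> 1 + norm (X m)"
      unfolding sum.distrib by (intro add_mono m sum_l1_nth_le_norm)
    finally show "(\<Sum>i<N. \<bar>g i\<bar>) \<le> 1 + norm (X m)" .
  qed auto
  then have nth: "l1_nth (Abs_l1 g) = g" by (simp add: Abs_l1_inverse)
  have "X \<longlonglongrightarrow> Abs_l1 g"
  proof (rule LIMSEQ_I)
    fix r :: real assume "0 < r"
    then obtain M where M: "\<forall>m\<ge>M. \<forall>N. (\<Sum>i<N. \<bar>l1_nth (X m) i - g i\<bar>) \<le> r / 2"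
      using tail[of "r / 2"] by auto
    have "norm (X m - Abs_l1 g) \<le> r / 2" if "M \<le> m" for m
      by (rule norm_l1_le) (use M that in \<open>simp add: minus_l1.rep_eq nth\<close>)
    then show "\<exists>M. \<forall>m\<ge>M. norm (X m - Abs_l1 g) < r"
      using \<open>0 < r\<close> by (intro exI[of _ M] allI impI) (rule le_less_trans[of _ "r / 2"], auto)
  qed
  then show "convergent X" by (auto simp: convergent_def)
qed

lift_definition l1_unit :: "nat \<Rightarrow> l1" is "\<lambda>i j. if j = i then 1 else 0"
  by (rule summable_finite[of "{i}" for i]) auto

lemma norm_sum_l1_unit: "norm (\<Sum>i<n. a i *\<^sub>R l1_unit i) = (\<Sum>i<n. \<bar>a i\<bar>)"
proof -
  have nth: "l1_nth (\<Sum>i<n. a i *\<^sub>R l1_unit i) k = (if k < n then a k else 0)" for k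
    by (induction n) (auto simp: zero_l1.rep_eq plus_l1.rep_eq scaleR_l1.rep_eq l1_unit.rep_eq less_Suc_eq)
  have "norm (\<Sum>i<n. a i *\<^sub>R l1_unit i) = (\<Sum>k. \<bar>if k < n then a k else 0\<bar>)"
    by (simp only: norm_l1.rep_eq nth)
  also have "\<dots> = (\<Sum>i<n. \<bar>if i < n then a i else 0\<bar>)"
    by (rule suminf_finite) auto
  finally show ?thesis by simp
qed


subsection \<open>Equivalence of sequences\<close>

definition equivalent_seq ::
  "(nat \<Rightarrow> 'a::real_normed_vector) \<Rightarrow> (nat \<Rightarrow> 'b::real_normed_vector) \<Rightarrow> bool" where
  "equivalent_seq x y \<longleftrightarrow>
     (\<exists>C>0. \<forall>a :: nat \<Rightarrow> real. finite {i. a i \<noteq> 0} \<longrightarrow>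
        (1 / C) * norm (\<Sum>i | a i \<noteq> 0. a i *\<^sub>R x i) \<le> norm (\<Sum>i | a i \<noteq> 0. a i *\<^sub>R y i) \<and>
        norm (\<Sum>i | a i \<noteq> 0. a i *\<^sub>R y i) \<le> C * norm (\<Sum>i | a i \<noteq> 0. a i *\<^sub>R x i))"

end

theory Submission
  imports Defs
begin

text \<open>Write \<open>\<alpha> = (\<Sum>i<n. a i *\<^sub>R e i)\<close>. Padding with zeros, \<open>e 1 \<otimes> \<alpha>\<close> is a
  shift of \<open>\<alpha>\<close> and \<open>\<alpha> \<otimes> e j\<close> a dilate of it, so all copies
  \<open>(\<Sum>i<n. a i *\<^sub>R e (t + m * i))\<close> of \<open>\<alpha>\<close> along arithmetic progressions are bounded by a
  multiple of \<open>norm \<alpha>\<close>. Take random signs \<open>\<epsilon>\<close> on \<open>{..<L}\<close> and add up the copies along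
  those progressions on which \<open>\<epsilon>\<close> agrees with the signs of \<open>a\<close>, and their negatives where it
  agrees with the opposite signs. If the differences are powers of \<open>n\<close>, then two progressions with
  \<open>x\<close> as their \<open>i\<close>-th term meet only in \<open>x\<close>, so by the second moment method nearly every \<open>x\<close> is
  covered about equally often, and the sum is close to a multiple of \<open>(\<Sum>x<L. \<epsilon> x *\<^sub>R e x)\<close>.
  As this vector has norm of order \<open>L\<close> on average, \<open>norm \<alpha>\<close> is at least a multiple of
  \<open>(\<Sum>i<n. \<bar>a i\<bar>)\<close>.\<close>

section \<open>Shifts and dilations from the multiplication\<close>

text \<open>Allowing \<open>b\<close> to end in zeros makes \<open>m\<close> a free block length, no
  longer tied to the length of the second factor. Products with a single basis vector then realise
  shifts and dilations by prescribed amounts.\<close>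

lemma otimes_padded_bound:
  fixes e :: "nat \<Rightarrow> 'a::real_normed_vector" and a b :: "nat \<Rightarrow> real"
  assumes e: "schauder_basis e"
    and K: "\<And>\<alpha> \<beta>. \<lbrakk>\<alpha> \<in> span (range e); \<beta> \<in> span (range e)\<rbrakk> \<Longrightarrow>
              norm (otimes e \<alpha> \<beta>) \<le> K * norm \<alpha> * norm \<beta>"
    and m: "0 < m"
  shows "norm (\<Sum>i<n. a i *\<^sub>R (\<Sum>j<m. b j *\<^sub>R e (i * m + j)))
           \<le> K * norm (\<Sum>i<n. a i *\<^sub>R e i) * norm (\<Sum>j<m. b j *\<^sub>R e j)"
proof -
  \<comment> \<open>\<open>otimes_sum\<close> needs a nonzero last coefficient, so perturb it and pass to the limit.\<close>
  define b' where "b' r = b(m - 1 := b (m - 1) + r)" for r :: real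
  define u where "u r = norm (\<Sum>i<n. a i *\<^sub>R (\<Sum>j<m. b' r j *\<^sub>R e (i * m + j)))" for r
  define v where "v r = K * norm (\<Sum>i<n. a i *\<^sub>R e i) * norm (\<Sum>j<m. b' r j *\<^sub>R e j)" for r
  have b': "((\<lambda>r. b' r j) \<longlongrightarrow> b j) (at 0)" for j
  proof (cases "j = m - 1")
    case True
    have "((\<lambda>r. b j + r) \<longlongrightarrow> b j + 0) (at 0)" by (intro tendsto_intros)
    then show ?thesis using True by (simp add: b'_def)
  qed (simp add: b'_def)
  have u: "(u \<longlongrightarrow> norm (\<Sum>i<n. a i *\<^sub>R (\<Sum>j<m. b j *\<^sub>R e (i * m + j)))) (at 0)"
    unfolding u_def by (intro tendsto_intros b')
  have v: "(v \<longlongrightarrow> K * norm (\<Sum>i<n. a i *\<^sub>R e i) * norm (\<Sum>j<m. b j *\<^sub>R e j)) (at 0)"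
    unfolding v_def by (intro tendsto_intros b')
  have "\<forall>\<^sub>F r in at 0. r \<noteq> - b (m - 1)"
  proof (cases "b (m - 1) = 0")
    case False
    then show ?thesis by (intro tendsto_imp_eventually_ne[OF tendsto_ident_at]) simp
  qed (simp add: eventually_at_filter)
  then have "\<forall>\<^sub>F r in at 0. u r \<le> v r"
  proof eventually_elim
    case (elim r)
    then have nz: "b' r (m - 1) \<noteq> 0" by (simp add: b'_def)
    have sp: "(\<Sum>i<k. c i *\<^sub>R e i) \<in> span (range e)" for k and c :: "nat \<Rightarrow> real"
      by (intro span_sum span_scale span_base) auto
    from K[OF sp[of a n] sp[of "b' r" m]] show ?case
      unfolding u_def v_def otimes_sum[where b = "b' r", OF e m nz] .
  qed
  then show ?thesis by (rule tendsto_le[OF _ v u, rotated]) simp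
qed

text \<open>Two products suffice, each costing a factor \<open>K * C\<close>. Multiplying
  \<open>e 1\<close> by \<alpha> in blocks of length \<open>T\<close> moves \<alpha> to start at
  \<open>T\<close>; multiplying the result by \<open>e j\<close> in blocks of length
  \<open>m\<close> sends index \<open>T + i\<close> to \<open>(T + i) * m + j\<close>. Division of
  \<open>t\<close> by \<open>m\<close> with remainder \<open>j\<close> makes this
  \<open>t + m * i\<close>, and \<open>t\<close> is large enough for \<alpha> to fit into one block
  of length \<open>T\<close>.\<close>

lemma progression_dominated:
  fixes e :: "nat \<Rightarrow> 'a::real_normed_vector" and a :: "nat \<Rightarrow> real"
  assumes e: "schauder_basis e"
    and K: "\<And>\<alpha> \<beta>. \<lbrakk>\<alpha> \<in> span (range e); \<beta> \<in> span (range e)\<rbrakk> \<Longrightarrow>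
              norm (otimes e \<alpha> \<beta>) \<le> K * norm \<alpha> * norm \<beta>"
    and K0: "0 \<le> K" and C: "\<And>i. norm (e i) \<le> C"
    and m: "0 < m" and t: "n * m \<le> t"
  shows "norm (\<Sum>i<n. a i *\<^sub>R e (t + m * i)) \<le> (K * C)\<^sup>2 * norm (\<Sum>i<n. a i *\<^sub>R e i)"
proof (cases "n = 0")
  case False
  define T where "T = t div m"
  define j where "j = t mod m"
  have C0: "0 \<le> C" using order_trans[OF norm_ge_zero C[of 0]] .
  have T: "n \<le> T" using t m by (simp add: T_def less_eq_div_iff_mult_less_eq)
  have j: "j < m" using m by (simp add: j_def)
  have tT: "t = T * m + j" by (simp add: T_def j_def)
  have pad: "(\<Sum>i<T. (if i < n then a i else 0) *\<^sub>R f i) = (\<Sum>i<n. a i *\<^sub>R f i)"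
    for f :: "nat \<Rightarrow> 'a"
    by (rule sum.mono_neutral_cong_right) (use T in auto)
  have single: "(\<Sum>i<N. (if i = l then 1 else 0) *\<^sub>R f i) = f l" if "l < N"
    for f :: "nat \<Rightarrow> 'a" and l N :: nat
    using that by (simp add: if_distrib[of "\<lambda>c. c *\<^sub>R _"] cong: if_cong)
  have shift: "norm (\<Sum>i<n. a i *\<^sub>R e (T + i)) \<le> K * C * norm (\<Sum>i<n. a i *\<^sub>R e i)"
  proof -
    \<comment> \<open>The right side is the product of \<open>e 1\<close> with \<alpha> padded to
      length \<open>T\<close>: only block number 1 survives, and it starts at
      \<open>T\<close>.\<close>
    have "norm (\<Sum>i<n. a i *\<^sub>R e (T + i)) =
        norm (\<Sum>l<2. (if l = 1 then 1 else 0) *\<^sub>R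
                (\<Sum>i<T. (if i < n then a i else 0) *\<^sub>R e (l * T + i)))"
      by (subst single) (simp_all add: pad)
    also have "\<dots> \<le> K * norm (\<Sum>l<2. (if l = 1 then 1 else 0::real) *\<^sub>R e l) *
                    norm (\<Sum>i<T. (if i < n then a i else 0) *\<^sub>R e i)"
      using T False by (intro otimes_padded_bound[OF e K]) auto
    also have "\<dots> = K * norm (e 1) * norm (\<Sum>i<n. a i *\<^sub>R e i)"
      by (subst single) (simp_all add: pad)
    also have "\<dots> \<le> K * C * norm (\<Sum>i<n. a i *\<^sub>R e i)"
      by (intro mult_mono mult_left_mono C K0 mult_nonneg_nonneg C0) auto
    finally show ?thesis .
  qed
  define a' where "a' i = (if i < T then 0 else a (i - T))" for i
  have a': "(\<Sum>i<T + n. a' i *\<^sub>R f i) = (\<Sum>i<n. a i *\<^sub>R f (T + i))" for f :: "nat \<Rightarrow> 'a"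
  proof -
    have "(\<Sum>i<T + n. a' i *\<^sub>R f i) = (\<Sum>i\<in>{T..<T + n}. a' i *\<^sub>R f i)"
      by (rule sum.mono_neutral_right) (auto simp: a'_def)
    also have "\<dots> = (\<Sum>i<n. a i *\<^sub>R f (T + i))"
      by (rule sum.reindex_bij_witness[of _ "\<lambda>i. T + i" "\<lambda>i. i - T"]) (auto simp: a'_def)
    finally show ?thesis .
  qed
  \<comment> \<open>Now the second factor is \<open>e j\<close> padded to length \<open>m\<close>,
    so only position \<open>j\<close> of each block is occupied.\<close>
  have "norm (\<Sum>i<n. a i *\<^sub>R e (t + m * i)) =
      norm (\<Sum>i<T + n. a' i *\<^sub>R (\<Sum>l<m. (if l = j then 1 else 0) *\<^sub>R e (i * m + l)))"
    unfolding single[OF j] a' by (simp add: tT algebra_simps)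
  also have "\<dots> \<le> K * norm (\<Sum>i<T + n. a' i *\<^sub>R e i) *
                  norm (\<Sum>l<m. (if l = j then 1 else 0::real) *\<^sub>R e l)"
    by (rule otimes_padded_bound[OF e K m])
  also have "\<dots> = K * norm (\<Sum>i<n. a i *\<^sub>R e (T + i)) * norm (e j)"
    unfolding single[OF j] a' ..
  also have "\<dots> \<le> K * (K * C * norm (\<Sum>i<n. a i *\<^sub>R e i)) * C"
    by (intro mult_mono mult_left_mono shift C K0 mult_nonneg_nonneg C0) auto
  also have "\<dots> = (K * C)\<^sup>2 * norm (\<Sum>i<n. a i *\<^sub>R e i)"
    by (simp add: power2_eq_square)
  finally show ?thesis .
qed simp

section \<open>Random signs and the second moment method\<close>

abbreviation signs :: "nat \<Rightarrow> (nat \<Rightarrow> real) set" where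
  "signs L \<equiv> {..<L} \<rightarrow>\<^sub>E {-1, 1}"

lemma finite_signs: "finite (signs L)"
  by (intro finite_PiE) auto

lemma card_signs: "card (signs L) = 2 ^ L"
  by (simp add: card_PiE numeral_2_eq_2)

lemma abs_signs: "\<epsilon> \<in> signs L \<Longrightarrow> x < L \<Longrightarrow> \<bar>\<epsilon> x\<bar> = 1"
  by (drule PiE_mem[of _ _ _ x]) auto

text \<open>Since \<open>p\<close> is injective, the event prescribes \<open>card J\<close> distinct
  coordinates and leaves the others free, so it is a box of probability
  \<open>1 / 2 ^ card J\<close>. Both single and joint probabilities of matches are computed this
  way.\<close>

lemma sum_signs_fixed:
  assumes J: "finite J" and inj: "inj_on p J" and p: "p ` J \<subseteq> {..<L}"
    and c: "\<And>j. j \<in> J \<Longrightarrow> c j \<in> {-1, 1}"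
  shows "(\<Sum>\<epsilon>\<in>signs L. of_bool (\<forall>j\<in>J. \<epsilon> (p j) = c j) :: real) = 2 ^ L / 2 ^ card J"
proof -
  define B where "B x = (if x \<in> p ` J then {c (the_inv_into J p x)} else {-1, 1})" for x
  have inv: "the_inv_into J p (p j) = j" if "j \<in> J" for j
    using inj that by (rule the_inv_into_f_f)
  have "{\<epsilon> \<in> signs L. \<forall>j\<in>J. \<epsilon> (p j) = c j} = Pi\<^sub>E {..<L} B" (is "?S = _")
  proof (intro set_eqI iffI)
    fix \<epsilon> assume "\<epsilon> \<in> ?S"
    then show "\<epsilon> \<in> Pi\<^sub>E {..<L} B" by (auto simp: B_def inv PiE_iff)
  next
    fix \<epsilon> assume \<epsilon>: "\<epsilon> \<in> Pi\<^sub>E {..<L} B"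
    have "\<epsilon> (p j) = c j" if "j \<in> J" for j
    proof -
      have "\<epsilon> (p j) \<in> B (p j)" using \<epsilon> p that by blast
      then show ?thesis using that by (simp add: B_def inv)
    qed
    moreover have "B x \<subseteq> {-1, 1}" for x
    proof (cases "x \<in> p ` J")
      case True
      then obtain j where "j \<in> J" "x = p j" by blast
      then show ?thesis using c[of j] by (simp add: B_def inv)
    qed (simp add: B_def)
    then have "\<epsilon> \<in> signs L" using \<epsilon> PiE_mono[of "{..<L}" B "\<lambda>_. {-1, 1}"] by blast
    ultimately show "\<epsilon> \<in> ?S" by simp
  qed
  then have "(\<Sum>\<epsilon>\<in>signs L. of_bool (\<forall>j\<in>J. \<epsilon> (p j) = c j) :: real) = real (card (Pi\<^sub>E {..<L} B))"
    by (simp add: of_bool_def finite_signs flip: sum.inter_filter)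
  also have "card (Pi\<^sub>E {..<L} B) = (\<Prod>x<L. if x \<in> p ` J then 1 else 2)"
    unfolding card_PiE[OF finite_lessThan] by (intro prod.cong) (auto simp: B_def)
  also have "\<dots> = 2 ^ card ({..<L} - p ` J)"
    by (simp add: prod.If_cases Diff_eq)
  also have "card ({..<L} - p ` J) = L - card J"
    using p J inj by (simp add: card_Diff_subset card_image)
  also have "real (2 ^ (L - card J)) = 2 ^ L / 2 ^ card J"
  proof -
    have "card J \<le> L"
      using card_mono[OF _ p] inj by (simp add: card_image)
    then have "(2::real) ^ L = 2 ^ (L - card J) * 2 ^ card J" by (simp flip: power_add)
    then show ?thesis by simp
  qed
  finally show ?thesis .
qed

text \<open>Idempotence makes every \<open>X k\<close> an indicator, so by pairwise independence the
  variance of the count is \<open>card M * (q * (1 - q))\<close>, at most \<open>card M\<close>. The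
  mean absolute deviation is then at most the square root of this bound.\<close>

lemma mean_deviation_pairwise_independent:
  fixes X :: "'k \<Rightarrow> 'w \<Rightarrow> real" and q :: real
  assumes M: "finite M"
    and idem: "\<And>k w. X k w * X k w = X k w"
    and mean: "\<And>k. k \<in> M \<Longrightarrow> (\<Sum>w\<in>\<Omega>. X k w) = q * card \<Omega>"
    and pair: "\<And>k l. \<lbrakk>k \<in> M; l \<in> M; k \<noteq> l\<rbrakk> \<Longrightarrow> (\<Sum>w\<in>\<Omega>. X k w * X l w) = q\<^sup>2 * card \<Omega>"
  shows "(\<Sum>w\<in>\<Omega>. \<bar>(\<Sum>k\<in>M. X k w) - card M * q\<bar>) \<le> card \<Omega> * sqrt (card M)"
proof (cases "M = {}")
  case False
  define d where "d = real (card M)"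
  define N where "N = real (card \<Omega>)"
  define Y where "Y w = (\<Sum>k\<in>M. X k w) - d * q" for w
  have d: "0 < d" using False M by (simp add: d_def card_gt_0_iff)
  have mean': "(\<Sum>w\<in>\<Omega>. \<Sum>k\<in>M. X k w) = d * q * N"
    by (subst sum.swap) (simp add: mean d_def N_def)
  have sq: "(\<Sum>w\<in>\<Omega>. (\<Sum>k\<in>M. X k w)\<^sup>2) = d * (q + (d - 1) * q\<^sup>2) * N"
  proof -
    have "(\<Sum>w\<in>\<Omega>. (\<Sum>k\<in>M. X k w)\<^sup>2) = (\<Sum>k\<in>M. \<Sum>l\<in>M. \<Sum>w\<in>\<Omega>. X k w * X l w)"
      by (simp add: power2_eq_square sum_product sum.swap[of _ _ \<Omega>])
    also have "\<dots> = (\<Sum>k\<in>M. (q + (d - 1) * q\<^sup>2) * N)"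
    proof (rule sum.cong[OF refl])
      fix k assume k: "k \<in> M"
      have "(\<Sum>l\<in>M. \<Sum>w\<in>\<Omega>. X k w * X l w) = q * N + (\<Sum>l\<in>M - {k}. q\<^sup>2 * N)"
        unfolding sum.remove[OF M k] idem mean[OF k] N_def
        by (intro arg_cong2[where f = "(+)"] refl sum.cong pair k) auto
      also have "real (card (M - {k})) = d - 1"
        using M k False by (simp add: d_def card_gt_0_iff of_nat_diff Suc_leI)
      then have "q * N + (\<Sum>l\<in>M - {k}. q\<^sup>2 * N) = (q + (d - 1) * q\<^sup>2) * N"
        by (simp only: sum_constant distrib_right mult.assoc)
      finally show "(\<Sum>l\<in>M. \<Sum>w\<in>\<Omega>. X k w * X l w) = (q + (d - 1) * q\<^sup>2) * N" .
    qed
    finally show ?thesis by (simp add: d_def)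
  qed
  have "(\<Sum>w\<in>\<Omega>. (Y w)\<^sup>2) =
      (\<Sum>w\<in>\<Omega>. (\<Sum>k\<in>M. X k w)\<^sup>2) - 2 * d * q * (\<Sum>w\<in>\<Omega>. \<Sum>k\<in>M. X k w) + (d * q)\<^sup>2 * N"
    by (simp add: Y_def power2_diff sum.distrib sum_subtractf sum_distrib_left N_def algebra_simps)
  also have "\<dots> = d * (q * (1 - q)) * N"
    unfolding mean' sq by (simp add: power2_eq_square algebra_simps)
  also have "\<dots> \<le> d * N"
  proof -
    have "0 \<le> (q - 1 / 2)\<^sup>2" by simp
    then have "q * (1 - q) \<le> 1" by (simp add: power2_eq_square algebra_simps)
    then show ?thesis using d by (simp add: N_def mult_right_mono mult_left_le)
  qed
  finally have var: "(\<Sum>w\<in>\<Omega>. (Y w)\<^sup>2) \<le> d * N" .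
  \<comment> \<open>The inequality between arithmetic and geometric means replaces Cauchy-Schwarz;
    the scale \<open>sqrt d\<close> balances the two terms.\<close>
  have "(\<Sum>w\<in>\<Omega>. \<bar>Y w\<bar>) \<le> (\<Sum>w\<in>\<Omega>. ((Y w)\<^sup>2 / sqrt d + sqrt d) / 2)"
  proof (rule sum_mono)
    fix w
    have "0 \<le> (\<bar>Y w\<bar> - sqrt d)\<^sup>2" by simp
    then have "2 * \<bar>Y w\<bar> * sqrt d \<le> (Y w)\<^sup>2 + sqrt d * sqrt d"
      by (simp add: power2_eq_square algebra_simps)
    then show "\<bar>Y w\<bar> \<le> ((Y w)\<^sup>2 / sqrt d + sqrt d) / 2"
      using d by (simp add: field_simps)
  qed
  also have "\<dots> = ((\<Sum>w\<in>\<Omega>. (Y w)\<^sup>2) / sqrt d + N * sqrt d) / 2"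
    by (simp add: sum.distrib N_def flip: sum_divide_distrib)
  also have "\<dots> \<le> (d * N / sqrt d + N * sqrt d) / 2"
    using var d by (intro divide_right_mono add_right_mono) auto
  also have "\<dots> = N * sqrt d"
    using d by (simp add: field_simps)
  finally show ?thesis by (simp add: Y_def d_def N_def)
qed simp

section \<open>Progressions whose differences are powers of n\<close>

text \<open>Both progressions have \<open>x\<close> as their \<open>i\<close>-th term. If they met
  again with \<open>k < l\<close>, cancelling \<open>n ^ k\<close> would show that \<open>n\<close>
  divides \<open>i' - i\<close>, which is nonzero and smaller than \<open>n\<close> in absolute
  value. The case \<open>l < k\<close> is symmetric.\<close>

lemma geometric_progressions_meet_once:
  fixes n i i' j' k l x :: nat
  assumes i: "i < n" and ij: "i' < n" "i' \<noteq> i" "j' < n" "j' \<noteq> i"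
    and x: "n ^ k * i \<le> x" "n ^ l * i \<le> x"
    and eq: "x - n ^ k * i + n ^ k * i' = x - n ^ l * i + n ^ l * j'"
  shows "k = l \<and> i' = j'"
proof -
  have main: "k = l" if "k \<le> l" "i' < n" "i' \<noteq> i"
    and eq: "int (n ^ k) * (int i' - int i) = int (n ^ l) * (int j' - int i)" for k l i' j'
  proof (rule ccontr)
    assume "k \<noteq> l"
    with \<open>k \<le> l\<close> have "n ^ l = n ^ k * (n * n ^ (l - k - 1))"
      by (simp flip: power_Suc power_add)
    with eq i have "int i' - int i = int n * (int (n ^ (l - k - 1)) * (int j' - int i))"
      by simp
    then have "int n dvd int i' - int i" by simp
    then have "int n \<le> \<bar>int i' - int i\<bar>"
      using \<open>i' \<noteq> i\<close> by (metis dvd_abs_iff eq_iff_diff_eq_0 int_int_eq zdvd_imp_le zero_less_abs_iff)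
    then show False using i \<open>i' < n\<close> by linarith
  qed
  \<comment> \<open>The lower bounds on \<open>x\<close> make the truncated subtractions exact, so
    the equation can be rearranged over the integers.\<close>
  have "int (x - n ^ k * i + n ^ k * i') = int (x - n ^ l * i + n ^ l * j')"
    using eq by simp
  then have eq': "int (n ^ k) * (int i' - int i) = int (n ^ l) * (int j' - int i)"
    using x by (simp add: of_nat_diff algebra_simps del: of_nat_power)
  have "k = l"
    using main[of k l i' j'] main[of l k j' i'] ij eq' by (metis nat_le_linear)
  with eq' i show ?thesis by simp
qed

text \<open>Moving the window by one step telescopes to two boundary terms. This compares sums over
  starting points of progressions with sums over their \<open>i\<close>-th terms.\<close>

lemma norm_sum_shift_diff_le:
  fixes f :: "nat \<Rightarrow> 'a::real_normed_vector"
  assumes f: "\<And>x. norm (f x) \<le> b"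
  shows "norm ((\<Sum>t\<in>{p..<q}. f (t + k)) - (\<Sum>t\<in>{p..<q}. f t)) \<le> 2 * real k * b"
proof (induction k)
  case (Suc k)
  have step: "norm ((\<Sum>t\<in>{p..<q}. f (t + Suc k)) - (\<Sum>t\<in>{p..<q}. f (t + k))) \<le> 2 * b"
  proof (cases "p \<le> q")
    case True
    have "(\<Sum>t\<in>{p..<q}. f (t + Suc k)) - (\<Sum>t\<in>{p..<q}. f (t + k)) = f (q + k) - f (p + k)"
      using sum_Suc_diff'[OF True, of "\<lambda>t. f (t + k)"] by (simp add: sum_subtractf)
    then show ?thesis
      using norm_triangle_ineq4[of "f (q + k)" "f (p + k)"] f[of "q + k"] f[of "p + k"] by simp
  next
    case False
    then show ?thesis using order_trans[OF norm_ge_zero f[of 0]] by simp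
  qed
  have "norm ((\<Sum>t\<in>{p..<q}. f (t + Suc k)) - (\<Sum>t\<in>{p..<q}. f t)) \<le> 2 * b + 2 * real k * b"
    using norm_triangle_mono[OF step Suc.IH] by simp
  then show ?case by (simp add: algebra_simps)
qed simp

text \<open>Of the progressions with \<open>x\<close> as \<open>i\<close>-th term, no two share
  another term. Hence, once the common coordinate \<open>x\<close> is left out, the events that
  \<epsilon> matches \<sigma> along them are pairwise independent, each of probability
  \<open>1 / 2 ^ (n - 1)\<close>.\<close>

lemma mean_count_matches:
  fixes \<sigma> :: "nat \<Rightarrow> real"
  assumes \<sigma>: "\<And>i. \<sigma> i \<in> {-1, 1}" and i: "i < n"
    and x: "n ^ D \<le> x" "x < L - n ^ D"
  shows "(\<Sum>\<epsilon>\<in>signs L.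
           \<bar>(\<Sum>k<D. of_bool (\<forall>j\<in>{..<n} - {i}. \<epsilon> (x - n ^ k * i + n ^ k * j) = \<sigma> j)) - D / 2 ^ (n - 1)\<bar>)
         \<le> 2 ^ L * sqrt D"
proof -
  define J where "J = {..<n} - {i}"
  define p where "p k j = x - n ^ k * i + n ^ k * j" for k j
  define X where "X k \<epsilon> = (of_bool (\<forall>j\<in>J. \<epsilon> (p k j) = \<sigma> j) :: real)" for k \<epsilon>
  have J: "finite J" "card J = n - 1" using i by (auto simp: J_def)
  \<comment> \<open>No progression is longer than \<open>n ^ D\<close>, so a margin of that width at
    both ends keeps all terms inside \<open>{..<L}\<close>.\<close>
  have le: "n ^ k * j \<le> n ^ D" if "k < D" "j < n" for k j
  proof -
    have "n ^ k * j \<le> n ^ Suc k" using that by simp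
    also have "\<dots> \<le> n ^ D" using that by (intro power_increasing) auto
    finally show ?thesis .
  qed
  have p: "p k j < L" if "k < D" "j \<in> J" for k j
    using le[of k j] that x by (auto simp: p_def J_def)
  have inj: "inj_on (case_prod p) ({..<D} \<times> J)"
  proof (rule inj_onI)
    fix z z' assume z: "z \<in> {..<D} \<times> J" "z' \<in> {..<D} \<times> J" "case_prod p z = case_prod p z'"
    obtain k j l j' where zz: "z = (k, j)" "z' = (l, j')" by (metis surj_pair)
    with z have *: "k < D" "j \<in> J" "l < D" "j' \<in> J" and eq: "p k j = p l j'" by auto
    have "k = l \<and> j = j'"
      by (rule geometric_progressions_meet_once[OF i _ _ _ _ _ _ eq[unfolded p_def]])
         (use * le[OF *(1) i] le[OF *(3) i] x in \<open>auto simp: J_def\<close>)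
    then show "z = z'" by (simp add: zz)
  qed
  have "(\<Sum>\<epsilon>\<in>signs L. \<bar>(\<Sum>k<D. X k \<epsilon>) - card {..<D} * (1 / 2 ^ (n - 1))\<bar>)
      \<le> card (signs L) * sqrt (card {..<D})"
  proof (rule mean_deviation_pairwise_independent)
    fix k assume k: "k \<in> {..<D}"
    have "inj_on (p k) J"
      using inj k by (auto simp: inj_on_def)
    then show "(\<Sum>\<epsilon>\<in>signs L. X k \<epsilon>) = 1 / 2 ^ (n - 1) * card (signs L)"
      unfolding X_def using k p by (subst sum_signs_fixed[OF J(1) _ _ \<sigma>]) (auto simp: J card_signs)
  next
    fix k l assume kl: "k \<in> {..<D}" "l \<in> {..<D}" "k \<noteq> l"
    \<comment> \<open>A joint match is a single match on twice as many coordinates, which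
      \<open>inj\<close> shows to be distinct.\<close>
    have "X k \<epsilon> * X l \<epsilon> = of_bool (\<forall>z\<in>{k, l} \<times> J. \<epsilon> (case_prod p z) = \<sigma> (snd z))" for \<epsilon>
      by (auto simp: X_def)
    then have "(\<Sum>\<epsilon>\<in>signs L. X k \<epsilon> * X l \<epsilon>) =
        (\<Sum>\<epsilon>\<in>signs L. of_bool (\<forall>z\<in>{k, l} \<times> J. \<epsilon> (case_prod p z) = \<sigma> (snd z)))"
      by simp
    also have "\<dots> = 2 ^ L / 2 ^ card ({k, l} \<times> J)"
    proof (rule sum_signs_fixed)
      show "inj_on (case_prod p) ({k, l} \<times> J)"
        by (rule inj_on_subset[OF inj]) (use kl in auto)
    qed (use J kl p \<sigma> in auto)
    also have "\<dots> = (1 / 2 ^ (n - 1))\<^sup>2 * card (signs L)"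
      using kl by (simp add: J card_signs card_cartesian_product power_mult power2_eq_square
          mult.commute[of 2] flip: power_add)
    finally show "(\<Sum>\<epsilon>\<in>signs L. X k \<epsilon> * X l \<epsilon>) = (1 / 2 ^ (n - 1))\<^sup>2 * card (signs L)" .
  qed (auto simp: X_def)
  then show ?thesis by (simp add: X_def J_def p_def card_signs)
qed

section \<open>Averaging the matched copies\<close>

text \<open>The three terms on the right have separate sources: at most \<open>D * L\<close> copies,
  each matched with probability \<open>1 / 2 ^ n\<close> and bounded by \<open>B\<close>; boundary
  terms from reindexing copies by their \<open>i\<close>-th terms; and the deviation of the number
  of matches from its mean.\<close>

lemma matched_progressions_bound:
  fixes e :: "nat \<Rightarrow> 'a::real_normed_vector" and a \<sigma> :: "nat \<Rightarrow> real"
  assumes C: "\<And>i. norm (e i) \<le> C"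
    and B: "\<And>t m. \<lbrakk>0 < m; n * m \<le> t\<rbrakk> \<Longrightarrow> norm (\<Sum>i<n. a i *\<^sub>R e (t + m * i)) \<le> B"
    and \<sigma>: "\<And>i. \<sigma> i \<in> {-1, 1}" and n: "0 < n"
  shows "(\<Sum>\<epsilon>\<in>signs L. D / 2 ^ (n - 1) *
            norm (\<Sum>i<n. \<Sum>x\<in>{n ^ D..<L - n ^ D}. (of_bool (\<epsilon> x = \<sigma> i) * a i) *\<^sub>R e x))
         \<le> 2 ^ L * (D * L * B / 2 ^ n + 2 * real (n ^ D) * C * D * (\<Sum>i<n. \<bar>a i\<bar>) + (\<Sum>i<n. \<bar>a i\<bar>) * C * L * sqrt D)"
proof -
  define W where "W = n ^ D"
  define I where "I = {W..<L - W}"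
  define s where "s = (\<Sum>i<n. \<bar>a i\<bar>)"
  define q :: real where "q = 1 / 2 ^ (n - 1)"
  define M where "M \<epsilon> t k = (of_bool (\<forall>i\<in>{..<n}. \<epsilon> (t + n ^ k * i) = \<sigma> i) :: real)" for \<epsilon> t k
  \<comment> \<open>\<open>M\<close> tests the whole progression, \<open>X\<close> all of it but its
    \<open>i\<close>-th term \<open>x\<close>. The condition at \<open>x\<close> is common to all
    \<open>k\<close> and is kept in \<open>H\<close>.\<close>
  define X where "X x i k \<epsilon> =
      (of_bool (\<forall>j\<in>{..<n} - {i}. \<epsilon> (x - n ^ k * i + n ^ k * j) = \<sigma> j) :: real)" for x i k \<epsilon>
  define H where "H \<epsilon> = (\<Sum>i<n. \<Sum>x\<in>I. (of_bool (\<epsilon> x = \<sigma> i) * a i) *\<^sub>R e x)" for \<epsilon>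
  define F where "F \<epsilon> = (\<Sum>k<D. \<Sum>t\<in>I. M \<epsilon> t k *\<^sub>R (\<Sum>i<n. a i *\<^sub>R e (t + n ^ k * i)))" for \<epsilon>
  define g where "g \<epsilon> k i x = (M \<epsilon> (x - n ^ k * i) k * a i) *\<^sub>R e x" for \<epsilon> k i x
  define G where "G \<epsilon> = (\<Sum>k<D. \<Sum>i<n. \<Sum>x\<in>I. g \<epsilon> k i x)" for \<epsilon>
  have C0: "0 \<le> C" using order_trans[OF norm_ge_zero C[of 0]] .
  have B0: "0 \<le> B" using order_trans[OF norm_ge_zero B[of 1 n]] by simp
  have s0: "0 \<le> s" by (simp add: s_def sum_nonneg)
  have cI: "card I \<le> L" by (simp add: I_def)
  have le: "n ^ k * i \<le> W" if "k < D" "i \<le> n" for k i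
  proof -
    have "n ^ k * i \<le> n ^ Suc k" using that by simp
    also have "\<dots> \<le> W" unfolding W_def using that n by (intro power_increasing) auto
    finally show ?thesis .
  qed
  have M: "0 \<le> M \<epsilon> t k" "M \<epsilon> t k \<le> 1" for \<epsilon> t k by (simp_all add: M_def)
  have F: "norm (F \<epsilon>) \<le> (\<Sum>k<D. \<Sum>t\<in>I. M \<epsilon> t k * B)" for \<epsilon>
    unfolding F_def
  proof (intro sum_norm_le)
    fix k t assume k: "k \<in> {..<D}" and t: "t \<in> I"
    have "n * n ^ k \<le> t" using le[of k n] k t by (simp add: I_def mult.commute)
    then show "norm (M \<epsilon> t k *\<^sub>R (\<Sum>i<n. a i *\<^sub>R e (t + n ^ k * i))) \<le> M \<epsilon> t k * B"
      using B[of "n ^ k" t] n M by (simp add: mult_left_mono)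
  qed
  \<comment> \<open>The substitution \<open>x = t + n ^ k * i\<close> moves the window
    \<open>I\<close> by at most \<open>W\<close>.\<close>
  have FG: "norm (F \<epsilon> - G \<epsilon>) \<le> 2 * W * C * D * s" for \<epsilon>
  proof -
    have "F \<epsilon> = (\<Sum>k<D. \<Sum>t\<in>I. \<Sum>i<n. g \<epsilon> k i (t + n ^ k * i))"
      by (simp add: F_def g_def scaleR_sum_right)
    also have "\<dots> = (\<Sum>k<D. \<Sum>i<n. \<Sum>t\<in>I. g \<epsilon> k i (t + n ^ k * i))"
      by (intro sum.cong refl sum.swap)
    finally have "F \<epsilon> = (\<Sum>k<D. \<Sum>i<n. \<Sum>t\<in>I. g \<epsilon> k i (t + n ^ k * i))" .
    then have "F \<epsilon> - G \<epsilon> =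
        (\<Sum>k<D. \<Sum>i<n. (\<Sum>t\<in>I. g \<epsilon> k i (t + n ^ k * i)) - (\<Sum>t\<in>I. g \<epsilon> k i t))"
      by (simp add: G_def sum_subtractf)
    also have "norm \<dots> \<le> (\<Sum>k<D. \<Sum>i<n. 2 * W * (\<bar>a i\<bar> * C))"
    proof (intro sum_norm_le)
      fix k i assume k: "k \<in> {..<D}" and i: "i \<in> {..<n}"
      have "norm (g \<epsilon> k i x) \<le> \<bar>a i\<bar> * C" for x
      proof -
        have "M \<epsilon> (x - n ^ k * i) k * \<bar>a i\<bar> * norm (e x) \<le> 1 * \<bar>a i\<bar> * C"
          by (intro mult_mono M C) (simp_all add: M)
        then show ?thesis using M by (simp add: g_def abs_mult)
      qed
      then have "norm ((\<Sum>t\<in>I. g \<epsilon> k i (t + n ^ k * i)) - (\<Sum>t\<in>I. g \<epsilon> k i t))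
          \<le> 2 * real (n ^ k * i) * (\<bar>a i\<bar> * C)"
        unfolding I_def by (rule norm_sum_shift_diff_le)
      also have "real (n ^ k * i) \<le> real W"
        using le[of k i] k i by (simp only: of_nat_le_iff lessThan_iff less_imp_le)
      then have "2 * real (n ^ k * i) * (\<bar>a i\<bar> * C) \<le> 2 * W * (\<bar>a i\<bar> * C)"
        using C0 by (intro mult_right_mono) auto
      finally show "norm ((\<Sum>t\<in>I. g \<epsilon> k i (t + n ^ k * i)) - (\<Sum>t\<in>I. g \<epsilon> k i t))
          \<le> 2 * W * (\<bar>a i\<bar> * C)" .
    qed
    also have "\<dots> = 2 * W * C * D * s"
      by (simp add: s_def sum_distrib_left sum_distrib_right mult_ac)
    finally show ?thesis .
  qed
  \<comment> \<open>Grouped by \<open>i\<close> and \<open>x\<close>, the coefficients in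
    \<open>G\<close> are those in \<open>H\<close> times the number of matches away from
    \<open>x\<close>, whose mean is \<open>D * q\<close>.\<close>
  have GH: "norm (G \<epsilon> - (D * q) *\<^sub>R H \<epsilon>)
      \<le> (\<Sum>i<n. \<Sum>x\<in>I. \<bar>a i\<bar> * C * \<bar>(\<Sum>k<D. X x i k \<epsilon>) - D * q\<bar>)" for \<epsilon>
  proof -
    have "g \<epsilon> k i x = (X x i k \<epsilon> * (of_bool (\<epsilon> x = \<sigma> i) * a i)) *\<^sub>R e x"
      if "k < D" "i < n" "x \<in> I" for k i x
    proof -
      have "x - n ^ k * i + n ^ k * i = x"
        using le[of k i] that by (auto simp: I_def)
      moreover have "(\<forall>j\<in>{..<n}. P j) \<longleftrightarrow> P i \<and> (\<forall>j\<in>{..<n} - {i}. P j)" for P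
        using that by auto
      ultimately have "M \<epsilon> (x - n ^ k * i) k = X x i k \<epsilon> * of_bool (\<epsilon> x = \<sigma> i)"
        by (simp add: M_def X_def of_bool_conj mult.commute)
      then show ?thesis by (simp add: g_def)
    qed
    then have "G \<epsilon> = (\<Sum>k<D. \<Sum>i<n. \<Sum>x\<in>I. (X x i k \<epsilon> * (of_bool (\<epsilon> x = \<sigma> i) * a i)) *\<^sub>R e x)"
      by (simp add: G_def)
    also have "\<dots> = (\<Sum>i<n. \<Sum>x\<in>I. \<Sum>k<D. (X x i k \<epsilon> * (of_bool (\<epsilon> x = \<sigma> i) * a i)) *\<^sub>R e x)"
      by (subst sum.swap) (intro sum.cong[OF refl] sum.swap)
    also have "\<dots> = (\<Sum>i<n. \<Sum>x\<in>I. ((\<Sum>k<D. X x i k \<epsilon>) * (of_bool (\<epsilon> x = \<sigma> i) * a i)) *\<^sub>R e x)"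
      by (simp only: scaleR_sum_left sum_distrib_right)
    finally have "G \<epsilon> - (D * q) *\<^sub>R H \<epsilon> =
        (\<Sum>i<n. \<Sum>x\<in>I. (((\<Sum>k<D. X x i k \<epsilon>) - D * q) * (of_bool (\<epsilon> x = \<sigma> i) * a i)) *\<^sub>R e x)"
      by (simp add: H_def scaleR_sum_right sum_subtractf left_diff_distrib scaleR_diff_left mult.assoc)
    also have "norm \<dots> \<le> (\<Sum>i<n. \<Sum>x\<in>I. \<bar>a i\<bar> * C * \<bar>(\<Sum>k<D. X x i k \<epsilon>) - D * q\<bar>)"
    proof (intro sum_norm_le)
      fix i x
      have "\<bar>(\<Sum>k<D. X x i k \<epsilon>) - D * q\<bar> * (of_bool (\<epsilon> x = \<sigma> i) * \<bar>a i\<bar>) * norm (e x)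
          \<le> \<bar>(\<Sum>k<D. X x i k \<epsilon>) - D * q\<bar> * (1 * \<bar>a i\<bar>) * C"
        by (intro mult_mono order_refl C) (auto simp: C0)
      then show "norm ((((\<Sum>k<D. X x i k \<epsilon>) - D * q) * (of_bool (\<epsilon> x = \<sigma> i) * a i)) *\<^sub>R e x)
          \<le> \<bar>a i\<bar> * C * \<bar>(\<Sum>k<D. X x i k \<epsilon>) - D * q\<bar>"
        by (simp add: abs_mult mult_ac)
    qed
    finally show ?thesis .
  qed
  have "(\<Sum>\<epsilon>\<in>signs L. D * q * norm (H \<epsilon>)) \<le>
      (\<Sum>\<epsilon>\<in>signs L. (\<Sum>k<D. \<Sum>t\<in>I. M \<epsilon> t k * B) + 2 * W * C * D * s +
          (\<Sum>i<n. \<Sum>x\<in>I. \<bar>a i\<bar> * C * \<bar>(\<Sum>k<D. X x i k \<epsilon>) - D * q\<bar>))"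
  proof (rule sum_mono)
    fix \<epsilon>
    have "D * q * norm (H \<epsilon>) = norm (F \<epsilon> - (F \<epsilon> - G \<epsilon>) - (G \<epsilon> - (D * q) *\<^sub>R H \<epsilon>))"
      by (simp add: q_def)
    also have "\<dots> \<le> norm (F \<epsilon>) + norm (F \<epsilon> - G \<epsilon>) + norm (G \<epsilon> - (D * q) *\<^sub>R H \<epsilon>)"
      by (intro order_trans[OF norm_triangle_ineq4] add_right_mono norm_triangle_ineq4)
    also have "\<dots> \<le> (\<Sum>k<D. \<Sum>t\<in>I. M \<epsilon> t k * B) + 2 * W * C * D * s +
        (\<Sum>i<n. \<Sum>x\<in>I. \<bar>a i\<bar> * C * \<bar>(\<Sum>k<D. X x i k \<epsilon>) - D * q\<bar>)"
      by (intro add_mono F FG GH)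
    finally show "D * q * norm (H \<epsilon>) \<le> \<dots>" .
  qed
  also have "\<dots> = (\<Sum>k<D. \<Sum>t\<in>I. (\<Sum>\<epsilon>\<in>signs L. M \<epsilon> t k) * B) + 2 ^ L * (2 * W * C * D * s) +
      (\<Sum>i<n. \<Sum>x\<in>I. \<bar>a i\<bar> * C * (\<Sum>\<epsilon>\<in>signs L. \<bar>(\<Sum>k<D. X x i k \<epsilon>) - D * q\<bar>))"
    by (simp only: sum.distrib sum_distrib_right sum_distrib_left sum.swap[of _ _ "signs L"]
        sum_constant card_signs of_nat_power of_nat_numeral)
  \<comment> \<open>The margins of \<open>I\<close> keep the progressions inside
    \<open>{..<L}\<close>, so \<open>sum_signs_fixed\<close> gives the match probability and
    \<open>mean_count_matches\<close> the deviation.\<close>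
  also have "\<dots> \<le> (\<Sum>k<D. \<Sum>t\<in>I. 2 ^ L / 2 ^ n * B) + 2 ^ L * (2 * W * C * D * s) +
      (\<Sum>i<n. \<Sum>x\<in>I. \<bar>a i\<bar> * C * (2 ^ L * sqrt D))"
  proof (intro add_mono order_refl sum_mono)
    fix k t assume k: "k \<in> {..<D}" and t: "t \<in> I"
    have "t + n ^ k * i < L" if "i < n" for i
      using le[of k i] that k t by (auto simp: I_def)
    then have "(\<Sum>\<epsilon>\<in>signs L. M \<epsilon> t k) = 2 ^ L / 2 ^ n"
      unfolding M_def using n by (subst sum_signs_fixed[OF _ _ _ \<sigma>]) (auto intro!: inj_onI)
    then show "(\<Sum>\<epsilon>\<in>signs L. M \<epsilon> t k) * B \<le> 2 ^ L / 2 ^ n * B" by simp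
  next
    fix i x assume "i \<in> {..<n}" "x \<in> I"
    then show "\<bar>a i\<bar> * C * (\<Sum>\<epsilon>\<in>signs L. \<bar>(\<Sum>k<D. X x i k \<epsilon>) - D * q\<bar>) \<le> \<bar>a i\<bar> * C * (2 ^ L * sqrt D)"
      using mean_count_matches[OF \<sigma>, of i n D x L] C0
      by (intro mult_left_mono) (auto simp: X_def q_def I_def W_def)
  qed
  also have "\<dots> = card I * (D * (2 ^ L / 2 ^ n * B) + s * C * (2 ^ L * sqrt D)) + 2 ^ L * (2 * W * C * D * s)"
  proof -
    have "(\<Sum>i<n. \<Sum>x\<in>I. \<bar>a i\<bar> * C * (2 ^ L * sqrt D)) =
        (\<Sum>i<n. \<bar>a i\<bar> * (card I * (C * (2 ^ L * sqrt D))))"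
      by (simp add: mult_ac)
    also have "\<dots> = s * (card I * (C * (2 ^ L * sqrt D)))"
      by (simp only: s_def sum_distrib_right)
    finally show ?thesis by (simp add: algebra_simps)
  qed
  also have "\<dots> \<le> L * (D * (2 ^ L / 2 ^ n * B) + s * C * (2 ^ L * sqrt D)) + 2 ^ L * (2 * W * C * D * s)"
    using cI B0 C0 s0 by (intro add_mono mult_right_mono order_refl) auto
  also have "\<dots> = 2 ^ L * (D * L * B / 2 ^ n + 2 * W * C * D * s + s * C * L * sqrt D)"
    by (simp add: algebra_simps)
  finally show ?thesis
    by (simp add: H_def I_def W_def s_def q_def)
qed

text \<open>The previous bound is used for \<open>a\<close> with its signs and for
  \<open>- a\<close> with the opposite signs. For each \<open>x\<close> and \<open>i\<close> exactly
  one of the two is active and contributes \<open>\<epsilon> x * \<bar>a i\<bar>\<close>, so the two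
  sums add up to \<open>s\<close> times the random sign sum over the window; the margins are
  estimated trivially.\<close>

lemma sign_average_le:
  fixes e :: "nat \<Rightarrow> 'a::real_normed_vector" and a :: "nat \<Rightarrow> real"
  assumes C: "\<And>i. norm (e i) \<le> C"
    and B: "\<And>t m. \<lbrakk>0 < m; n * m \<le> t\<rbrakk> \<Longrightarrow> norm (\<Sum>i<n. a i *\<^sub>R e (t + m * i)) \<le> B"
    and s: "s = (\<Sum>i<n. \<bar>a i\<bar>)" "0 < s" and D: "0 < D" and L: "2 * n ^ D \<le> L"
  shows "sign_average e L
           \<le> L * (B / s + 2 ^ n * C / sqrt D) + (2 ^ n + 1) * (2 * real (n ^ D) * C)"
proof -
  define W where "W = n ^ D"
  define I where "I = {W..<L - W}"
  define q :: real where "q = 1 / 2 ^ (n - 1)"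
  \<comment> \<open>The choice at \<open>a i = 0\<close> is harmless, since the coefficient vanishes
    there.\<close>
  define \<sigma> where "\<sigma> i = (if a i \<ge> 0 then 1 else - 1 :: real)" for i
  define H where "H \<tau> \<epsilon> =
      (\<Sum>i<n. \<Sum>x\<in>I. (of_bool (\<epsilon> x = \<tau> * \<sigma> i) * (\<tau> * a i)) *\<^sub>R e x)" for \<tau> \<epsilon>
  define R where "R = 2 ^ L * (D * L * B / 2 ^ n + 2 * W * C * D * s + s * C * L * sqrt D)"
  have n: "0 < n" using s by (cases n) auto
  have Dq: "0 < D * q * s" using D s by (simp add: q_def)
  have R: "(\<Sum>\<epsilon>\<in>signs L. D * q * norm (H \<tau> \<epsilon>)) \<le> R" if "\<tau> \<in> {-1, 1}" for \<tau>
  proof -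
    have B': "norm (\<Sum>i<n. (\<tau> * a i) *\<^sub>R e (t + m * i)) \<le> B" if "0 < m" "n * m \<le> t" for t m
      using B[OF that] \<open>\<tau> \<in> {-1, 1}\<close> by (auto simp: sum_negf)
    have \<sigma>: "\<tau> * \<sigma> i \<in> {-1, 1}" for i
      using that by (auto simp: \<sigma>_def)
    have "(\<Sum>i<n. \<bar>\<tau> * a i\<bar>) = s"
      using that by (auto simp: s)
    with matched_progressions_bound[OF C B' \<sigma> n, where L = L and D = D] show ?thesis
      by (simp add: H_def R_def I_def W_def q_def)
  qed
  have HH: "H 1 \<epsilon> + H (- 1) \<epsilon> = s *\<^sub>R (\<Sum>x\<in>I. \<epsilon> x *\<^sub>R e x)" if \<epsilon>: "\<epsilon> \<in> signs L" for \<epsilon>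
  proof -
    have "of_bool (\<epsilon> x = 1 * \<sigma> i) * (1 * a i) + of_bool (\<epsilon> x = - 1 * \<sigma> i) * (- 1 * a i) = \<epsilon> x * \<bar>a i\<bar>"
      if "x \<in> I" for x i
    proof -
      have "\<epsilon> x \<in> {-1, 1}" using PiE_mem[OF \<epsilon>, of x] that by (auto simp: I_def)
      then show ?thesis by (auto simp: \<sigma>_def)
    qed
    then have "H 1 \<epsilon> + H (- 1) \<epsilon> = (\<Sum>i<n. \<Sum>x\<in>I. (\<epsilon> x * \<bar>a i\<bar>) *\<^sub>R e x)"
      unfolding H_def sum.distrib[symmetric] scaleR_left_distrib[symmetric]
      by (intro sum.cong refl) (simp only:)
    also have "\<dots> = (\<Sum>i<n. \<bar>a i\<bar> *\<^sub>R (\<Sum>x\<in>I. \<epsilon> x *\<^sub>R e x))"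
      by (simp add: scaleR_sum_right mult.commute)
    finally show ?thesis by (simp add: s scaleR_sum_left)
  qed
  have "D * q * s * (\<Sum>\<epsilon>\<in>signs L. norm (\<Sum>x<L. \<epsilon> x *\<^sub>R e x)) \<le>
      (\<Sum>\<epsilon>\<in>signs L. D * q * norm (H 1 \<epsilon>) + D * q * norm (H (- 1) \<epsilon>) + D * q * s * (2 * W * C))"
    unfolding sum_distrib_left
  proof (rule sum_mono)
    fix \<epsilon> assume \<epsilon>: "\<epsilon> \<in> signs L"
    \<comment> \<open>The assumption \<open>2 * n ^ D \<le> L\<close> keeps the two margins
      disjoint.\<close>
    have I: "I \<subseteq> {..<L}" "card ({..<L} - I) = 2 * W"
    proof -
      show sub: "I \<subseteq> {..<L}" by (auto simp: I_def)
      show "card ({..<L} - I) = 2 * W"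
        using card_Diff_subset[OF _ sub] L by (simp add: I_def W_def)
    qed
    have "norm (\<Sum>x\<in>{..<L} - I. \<epsilon> x *\<^sub>R e x) \<le> (\<Sum>x\<in>{..<L} - I. C)"
      by (intro sum_norm_le) (use C abs_signs[OF \<epsilon>] in auto)
    also have "\<dots> = 2 * W * C" by (simp add: I)
    finally have rest: "norm (\<Sum>x\<in>{..<L} - I. \<epsilon> x *\<^sub>R e x) \<le> 2 * W * C" .
    have "s * norm (\<Sum>x\<in>I. \<epsilon> x *\<^sub>R e x) = norm (H 1 \<epsilon> + H (- 1) \<epsilon>)"
      using s by (simp add: HH[OF \<epsilon>])
    also have "\<dots> \<le> norm (H 1 \<epsilon>) + norm (H (- 1) \<epsilon>)" by (rule norm_triangle_ineq)
    finally have main: "s * norm (\<Sum>x\<in>I. \<epsilon> x *\<^sub>R e x) \<le> norm (H 1 \<epsilon>) + norm (H (- 1) \<epsilon>)" .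
    have "s * norm (\<Sum>x<L. \<epsilon> x *\<^sub>R e x) \<le>
        s * (norm (\<Sum>x\<in>{..<L} - I. \<epsilon> x *\<^sub>R e x) + norm (\<Sum>x\<in>I. \<epsilon> x *\<^sub>R e x))"
      using s by (subst sum.subset_diff[OF I(1)]) (auto intro!: mult_left_mono norm_triangle_ineq)
    also have "\<dots> \<le> s * (2 * W * C) + (norm (H 1 \<epsilon>) + norm (H (- 1) \<epsilon>))"
      unfolding distrib_left using mult_left_mono[OF rest less_imp_le[OF s(2)]] main by simp
    finally have "D * q * (s * norm (\<Sum>x<L. \<epsilon> x *\<^sub>R e x)) \<le>
        D * q * (s * (2 * W * C) + (norm (H 1 \<epsilon>) + norm (H (- 1) \<epsilon>)))"
      by (rule mult_left_mono) (simp add: q_def)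
    then show "D * q * s * norm (\<Sum>x<L. \<epsilon> x *\<^sub>R e x) \<le>
        D * q * norm (H 1 \<epsilon>) + D * q * norm (H (- 1) \<epsilon>) + D * q * s * (2 * W * C)"
      by (simp add: algebra_simps)
  qed
  also have "\<dots> \<le> R + R + 2 ^ L * (D * q * s * (2 * W * C))"
    unfolding sum.distrib by (intro add_mono R) (auto simp: card_signs)
  finally have "D * q * s * (\<Sum>\<epsilon>\<in>signs L. norm (\<Sum>x<L. \<epsilon> x *\<^sub>R e x))
      \<le> 2 * R + 2 ^ L * (D * q * s * (2 * W * C))" by simp
  from divide_right_mono[OF this, of "2 ^ L"]
  have "D * q * s * sign_average e L \<le> (2 * R + 2 ^ L * (D * q * s * (2 * W * C))) / 2 ^ L"
    by (simp add: sign_average_def)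
  also have "\<dots> = 2 * (D * L * B / 2 ^ n + 2 * W * C * D * s + s * C * L * sqrt D) + D * q * s * (2 * W * C)"
    by (simp add: R_def add_divide_distrib)
  also have "\<dots> = D * q * s * (L * (B / s + 2 ^ n * C / sqrt D) + (2 ^ n + 1) * (2 * W * C))"
  proof -
    \<comment> \<open>With \<open>r = sqrt D\<close> and \<open>P = 2 ^ (n - 1)\<close>, so that
      \<open>q = 1 / P\<close>, the identity becomes rational.\<close>
    have alg: "2 * (r * r * l * B / (2 * P) + 2 * w * C * (r * r) * s + s * C * l * r) +
            r * r * (1 / P) * s * (2 * w * C) =
        r * r * (1 / P) * s * (l * (B / s + 2 * P * C / r) + (2 * P + 1) * (2 * w * C))"
      if "0 < r" "0 < P" for r P l w :: real
      using that s(2) by (simp add: field_simps)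
    have pow: "(2::real) ^ n = 2 * 2 ^ (n - 1)" using n by (simp flip: power_Suc)
    show ?thesis
      unfolding q_def pow using alg[of "sqrt D" "2 ^ (n - 1)" L W] D by simp
  qed
  finally show ?thesis
    by (simp only: W_def mult_le_cancel_left_pos[OF Dq])
qed

section \<open>The lower estimate and the equivalence\<close>

text \<open>Two limits remove the errors in \<open>sign_average_le\<close> after division by
  \<open>L\<close>. First \<open>L\<close> grows with \<open>D\<close> fixed, killing the boundary
  term despite its factor \<open>n ^ D\<close>; then \<open>D\<close> grows, killing the deviation.
  What remains is \<open>\<delta> \<le> B / s\<close>.\<close>

lemma l1_lower_estimate:
  fixes e :: "nat \<Rightarrow> 'a::real_normed_vector" and a :: "nat \<Rightarrow> real"
  assumes C: "\<And>i. norm (e i) \<le> C"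
    and B: "\<And>t m. \<lbrakk>0 < m; n * m \<le> t\<rbrakk> \<Longrightarrow> norm (\<Sum>i<n. a i *\<^sub>R e (t + m * i)) \<le> B"
    and \<delta>: "\<exists>\<^sub>F L in sequentially. \<delta> < sign_average e L / L"
  shows "\<delta> * (\<Sum>i<n. \<bar>a i\<bar>) \<le> B"
proof (cases "(\<Sum>i<n. \<bar>a i\<bar>) = 0")
  case True
  have "0 \<le> B" using order_trans[OF norm_ge_zero B[of 1 n]] by simp
  with True show ?thesis by simp
next
  case False
  define s where "s = (\<Sum>i<n. \<bar>a i\<bar>)"
  have s: "0 < s" using False by (simp add: s_def order_less_le sum_nonneg)
  have *: "\<delta> \<le> B / s + 2 ^ n * C / sqrt D" if D: "0 < D" for D :: nat
  proof (rule ccontr)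
    assume "\<not> \<delta> \<le> B / s + 2 ^ n * C / sqrt D"
    moreover have "(\<lambda>L. B / s + 2 ^ n * C / sqrt D + (2 ^ n + 1) * (2 * real (n ^ D) * C) / real L)
        \<longlonglongrightarrow> B / s + 2 ^ n * C / sqrt D + 0"
      by (intro tendsto_intros lim_const_over_n)
    ultimately have "\<forall>\<^sub>F L in sequentially.
        B / s + 2 ^ n * C / sqrt D + (2 ^ n + 1) * (2 * real (n ^ D) * C) / real L < \<delta>"
      by (intro order_tendstoD(2)) auto
    then have "\<forall>\<^sub>F L in sequentially. \<not> \<delta> < sign_average e L / L"
      using eventually_ge_at_top[of "2 * n ^ D"] eventually_gt_at_top[of 0]
    proof eventually_elim
      case (elim L)
      have "sign_average e L \<le>
          L * (B / s + 2 ^ n * C / sqrt D) + (2 ^ n + 1) * (2 * real (n ^ D) * C)"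
        by (rule sign_average_le[OF C B s_def s D elim(2)])
      then have "sign_average e L / L \<le>
          (L * (B / s + 2 ^ n * C / sqrt D) + (2 ^ n + 1) * (2 * real (n ^ D) * C)) / L"
        by (rule divide_right_mono) simp
      also have "\<dots> = B / s + 2 ^ n * C / sqrt D + (2 ^ n + 1) * (2 * real (n ^ D) * C) / L"
        using elim by (simp add: add_divide_distrib)
      finally show ?case using elim by simp
    qed
    with \<delta> show False by (simp add: frequently_def)
  qed
  \<comment> \<open>The bound \<open>*\<close> no longer involves \<open>L\<close>, so
    \<open>D\<close> may now tend to infinity.\<close>
  have "(\<lambda>D. B / s + 2 ^ n * C / sqrt (real D)) \<longlonglongrightarrow> B / s + 0"
    by (intro tendsto_add tendsto_const real_tendsto_divide_at_top[OF tendsto_const] filterlim_compose[OF sqrt_at_top]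
        filterlim_real_sequentially)
  moreover have "\<forall>\<^sub>F D in sequentially. \<delta> \<le> B / s + 2 ^ n * C / sqrt (real D)"
    using eventually_gt_at_top[of 0] by eventually_elim (rule *)
  ultimately have "\<delta> \<le> B / s + 0"
    by (intro tendsto_lowerbound) auto
  then show ?thesis using s by (simp add: field_simps flip: s_def)
qed

theorem theorem8:
  fixes e :: "nat \<Rightarrow> 'a::banach"
  assumes "semi_normalized e"
    and "schauder_basis e"
    and "\<exists>K>0. \<forall>\<alpha>\<in>span (range e). \<forall>\<beta>\<in>span (range e).
           norm (otimes e \<alpha> \<beta>) \<le> K * norm \<alpha> * norm \<beta>"
    and "limsup (\<lambda>n. ereal (sign_average e n / real n)) > 0"
  shows "equivalent_seq e l1_unit"
proof -
  obtain C where C: "\<And>i. norm (e i) \<le> C"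
    using assms(1) unfolding semi_normalized_def bdd_above_def by blast
  have C0: "0 \<le> C" using order_trans[OF norm_ge_zero C[of 0]] .
  obtain K where K0: "0 < K"
    and K: "\<And>\<alpha> \<beta>. \<lbrakk>\<alpha> \<in> span (range e); \<beta> \<in> span (range e)\<rbrakk> \<Longrightarrow>
              norm (otimes e \<alpha> \<beta>) \<le> K * norm \<alpha> * norm \<beta>"
    using assms(3) by blast
  obtain \<delta> where \<delta>: "0 < ereal \<delta>" "ereal \<delta> < limsup (\<lambda>n. ereal (sign_average e n / real n))"
    using ereal_dense2[OF assms(4)] by blast
  then have freq: "\<exists>\<^sub>F L in sequentially. \<delta> < sign_average e L / L"
    using Limsup_bounded[of "\<lambda>n. ereal (sign_average e n / real n)" "ereal \<delta>" sequentially]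
    unfolding frequently_def not_less ereal_less_eq by (meson leD)
  \<comment> \<open>The summand 1 ensures positivity, \<open>C\<close> serves the trivial upper
    estimate by the l1 norm, and the last summand serves the lower one.\<close>
  define A where "A = 1 + C + (K * C)\<^sup>2 / \<delta>"
  have \<delta>0: "0 < \<delta>" using \<delta> by simp
  have A: "0 < A" "C \<le> A" "(K * C)\<^sup>2 / \<delta> \<le> A"
    unfolding A_def using C0 divide_nonneg_pos[OF zero_le_power2 \<delta>0, of "K * C"] by linarith+
  show ?thesis
    unfolding equivalent_seq_def
  proof (intro exI[of _ A] conjI allI impI)
    fix a :: "nat \<Rightarrow> real" assume fin: "finite {i. a i \<noteq> 0}"
    then obtain n where "{i. a i \<noteq> 0} \<subseteq> {..<n}"
      using finite_nat_bounded by metis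
    then have n: "\<And>i. a i \<noteq> 0 \<Longrightarrow> i < n" by auto
    define s where "s = (\<Sum>i<n. \<bar>a i\<bar>)"
    have sum_eq: "(\<Sum>i | a i \<noteq> 0. a i *\<^sub>R f i) = (\<Sum>i<n. a i *\<^sub>R f i)" for f :: "nat \<Rightarrow> 'b::real_normed_vector"
      by (rule sum.mono_neutral_left) (use n in auto)
    have "norm (\<Sum>i<n. a i *\<^sub>R e i) \<le> (\<Sum>i<n. \<bar>a i\<bar> * C)"
      by (intro sum_norm_le) (simp add: C mult_left_mono)
    also have "\<dots> = C * s" by (simp add: s_def sum_distrib_left mult.commute)
    also have "\<dots> \<le> A * s" using A by (intro mult_right_mono) (auto simp: s_def sum_nonneg)
    finally show "1 / A * norm (\<Sum>i | a i \<noteq> 0. a i *\<^sub>R e i) \<le> norm (\<Sum>i | a i \<noteq> 0. a i *\<^sub>R l1_unit i)"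
      using A by (simp add: sum_eq norm_sum_l1_unit field_simps flip: s_def)
    \<comment> \<open>Here \<open>B\<close> is the bound
      \<open>(K * C)\<^sup>2 * norm \<alpha>\<close> for all copies of \<alpha>, from
      \<open>progression_dominated\<close>.\<close>
    have "\<delta> * s \<le> (K * C)\<^sup>2 * norm (\<Sum>i<n. a i *\<^sub>R e i)"
      unfolding s_def
      by (rule l1_lower_estimate[OF C progression_dominated[OF assms(2) K less_imp_le[OF K0] C] freq])
    then have "s \<le> (K * C)\<^sup>2 / \<delta> * norm (\<Sum>i<n. a i *\<^sub>R e i)"
      using \<delta>0 by (simp add: field_simps)
    also have "\<dots> \<le> A * norm (\<Sum>i<n. a i *\<^sub>R e i)"
      using A by (intro mult_right_mono) auto
    finally show "norm (\<Sum>i | a i \<noteq> 0. a i *\<^sub>R l1_unit i) \<le> A * norm (\<Sum>i | a i \<noteq> 0. a i *\<^sub>R e i)"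
      by (simp add: sum_eq norm_sum_l1_unit flip: s_def)
  qed (rule A)
qed

end
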